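(* Let $d \ge 1$ be an integer, let $M \in \mathbb{N}$, and let $\mathcal{X} = \{X \mid X \subset \mathbb{R}^d,\ |X| \le M\}$ be the collection of all finite subsets of $\mathbb{R}^d$ with at most $M$ elements. Then there exist a positive integer $D$ and infinitely many continuous functions $\Phi : \mathbb{R}^d \to \mathbb{R}^D$ such that the set function $f : \mathcal{X} \to \mathbb{R}^D$ defined by $f(X) = \sum_{\mathbf{x} \in X} \Phi(\mathbf{x})$ is a continuous set function and is injective on $\mathcal{X}$.
   Context: A set function $f$ on $\mathcal{X} = \{X \mid X \subset \mathbb{R}^d, |X| \le M\}$ is a function whose argument is a set $X \in \mathcal{X}$. It can be represented by a sequence of permutation-invariant functions $f_i$, one for each set size $i \le M$, via $f(X) = f_i(x_1, \dots, x_i)$ whenever $|X| = i$ and $X = \{x_1, \dots, x_i\}$. The set function $f$ is called a continuous set function if, for every $i \le M$, the function $(x_1, \dots, x_i) \mapsto f_i(x_1, \dots, x_i)$ is continuous in the ordinary (Euclidean) sense, as a function of the tuple $(x_1,\dots,x_i)$ of pairwise distinct points, viewed as a point of $(\mathbb{R}^d)^i$. The empty sum is $0$. *)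

theory Defs
  imports "HOL-Analysis.Analysis"
begin

definition sets_upto :: "nat \<Rightarrow> 'a set set" where
  "sets_upto M = {X. finite X \<and> card X \<le> M}"

(* f is a continuous set function on sets_upto M: for each i \<le> M its size-i component
   (x_0, ..., x_(i-1)) \<mapsto> f {x_0, ..., x_(i-1)} is continuous on the pairwise distinct tuples.
   An i-tuple is an element of the i-fold power of the topological space 'a, that is, an
   extensional function on {..<i}. The component is permutation-invariant by construction.
   The topology T is the codomain; continuous_map also requires values in topspace T. *)
definition continuous_set_function ::
    "nat \<Rightarrow> 'b topology \<Rightarrow> ('a::topological_space set \<Rightarrow> 'b) \<Rightarrow> bool" where
  "continuous_set_function M T f \<longleftrightarrow>
     (\<forall>i\<le>M. continuous_map
        (subtopology (product_topology (\<lambda>_. euclidean) {..<i}) {x. inj_on x {..<i}})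
        T
        (\<lambda>x. f (x ` {..<i})))"

(* The codomain R^D has D bound inside the theorem, so its vectors are the points of
   Euclidean_space D (sequences vanishing from index D on), added coordinatewise. *)
definition sum_set_function :: "('a \<Rightarrow> nat \<Rightarrow> real) \<Rightarrow> 'a set \<Rightarrow> nat \<Rightarrow> real" where
  "sum_set_function \<Phi> X = (\<lambda>k. \<Sum>x\<in>X. \<Phi> x k)"

end

theory Submission
  imports Defs
begin

text \<open>
  Let \<open>\<Phi>\<close> list all monomials of degree at most \<open>2 * M\<close> in the coordinates.
  If \<open>X \<noteq> Y\<close>, say \<open>z \<in> X - Y\<close>, then multiplying one linear factor
  \<open>x $ i - w $ i\<close> with \<open>z $ i \<noteq> w $ i\<close> for each other point \<open>w\<close> of \<open>X \<union> Y\<close> gives a polynomial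
  of degree less than \<open>2 * M\<close> whose sum over \<open>X\<close> is nonzero and whose sum over \<open>Y\<close> is zero.
  So some monomial has different sums over \<open>X\<close> and \<open>Y\<close>. Scaling \<open>\<Phi>\<close> by positive reals gives
  infinitely many maps.
\<close>

text \<open>A monomial is encoded by a list of coordinates, so it may occur several times in the
  enumeration; this is harmless because the dimension \<open>D\<close> is free.\<close>

definition list_monomial :: "'d list \<Rightarrow> real ^ 'd \<Rightarrow> real" where
  "list_monomial l x = (\<Prod>i\<leftarrow>l. x $ i)"

lemma list_monomial_Nil [simp]: "list_monomial [] x = 1"
  by (simp add: list_monomial_def)

lemma list_monomial_Cons [simp]: "list_monomial (i # l) x = x $ i * list_monomial l x"
  by (simp add: list_monomial_def)

lemma continuous_on_list_monomial: "continuous_on S (list_monomial l)"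
  by (induction l) (auto intro!: continuous_intros)

text \<open>Expanding one linear factor leaves two sums with fewer factors: one in which the list
  gains a coordinate, one scaled by a constant. Hence \<open>l\<close> is arbitrary in the
  induction, and the bound on \<open>length l + card W\<close> is preserved.\<close>

lemma sum_linear_factors_eq:
  fixes X Y :: "(real ^ 'd) set"
  assumes eq: "\<And>l. length l \<le> n \<Longrightarrow> (\<Sum>x\<in>X. list_monomial l x) = (\<Sum>x\<in>Y. list_monomial l x)"
    and "finite W" "length l + card W \<le> n"
  shows "(\<Sum>x\<in>X. list_monomial l x * (\<Prod>w\<in>W. x $ s w - a w)) =
         (\<Sum>x\<in>Y. list_monomial l x * (\<Prod>w\<in>W. x $ s w - a w))"
  using assms(2,3)
proof (induction W arbitrary: l rule: finite_induct)
  case empty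
  then show ?case by (simp add: eq)
next
  case (insert v W)
  have split: "(\<Sum>x\<in>Z. list_monomial l x * (\<Prod>w\<in>insert v W. x $ s w - a w)) =
      (\<Sum>x\<in>Z. list_monomial (s v # l) x * (\<Prod>w\<in>W. x $ s w - a w)) -
      a v * (\<Sum>x\<in>Z. list_monomial l x * (\<Prod>w\<in>W. x $ s w - a w))" for Z
    using insert.hyps by (simp add: sum_distrib_left sum_subtractf [symmetric] algebra_simps)
  show ?case
    unfolding split using insert.IH [of l] insert.IH [of "s v # l"] insert.prems insert.hyps by simp
qed

lemma subset_if_list_monomial_sums_eq:
  fixes X Y :: "(real ^ 'd) set"
  assumes eq: "\<And>l. length l \<le> n \<Longrightarrow> (\<Sum>x\<in>X. list_monomial l x) = (\<Sum>x\<in>Y. list_monomial l x)"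
    and fin: "finite X" "finite Y" and "card X + card Y \<le> n"
  shows "X \<subseteq> Y"
proof
  fix z assume "z \<in> X"
  show "z \<in> Y"
  proof (rule ccontr)
    assume "z \<notin> Y"
    \<comment> \<open>\<open>W\<close> contains all of \<open>X\<close> except \<open>z\<close> and,
      since \<open>z\<close> is not in \<open>Y\<close>, all of \<open>Y\<close>. A product
      vanishing on \<open>W\<close> therefore sums to its value at \<open>z\<close> over
      \<open>X\<close> and to 0 over \<open>Y\<close>.\<close>
    define W where "W = X \<union> Y - {z}"
    have "\<exists>i. z $ i \<noteq> w $ i" if "w \<in> W" for w
      using that by (metis DiffD2 W_def singletonI vec_eq_iff)
    then obtain s where s: "\<And>w. w \<in> W \<Longrightarrow> z $ s w \<noteq> w $ s w"
      by metis
    have "finite W"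
      using fin by (simp add: W_def)
    have "card W \<le> card (X \<union> Y)"
      unfolding W_def using fin by (intro card_mono) auto
    also have "\<dots> \<le> n"
      using card_Un_le [of X Y] assms(4) by linarith
    finally have "card W \<le> n" .
    define p where "p x = (\<Prod>w\<in>W. x $ s w - w $ s w)" for x
    have vanish: "p x = 0" if "x \<in> W" for x
      unfolding p_def using that \<open>finite W\<close> by (intro prod_zero) auto
    have "p z \<noteq> 0"
      using s \<open>finite W\<close> by (simp add: p_def)
    have "p z = (\<Sum>x\<in>X. p x)"
      using \<open>z \<in> X\<close> fin vanish by (simp add: sum.remove [of X z] W_def)
    also have "\<dots> = (\<Sum>x\<in>Y. p x)"
      using sum_linear_factors_eq [OF eq \<open>finite W\<close>, of n "[]" s "\<lambda>w. w $ s w"] \<open>card W \<le> n\<close>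
      by (simp add: p_def)
    also have "\<dots> = 0"
      using \<open>z \<notin> Y\<close> vanish by (intro sum.neutral) (auto simp: W_def)
    finally show False
      using \<open>p z \<noteq> 0\<close> by simp
  qed
qed

text \<open>Continuity into \<open>Euclidean_space D\<close> is checked coordinatewise, and on
  tuples of pairwise distinct points the sum over the set is the sum over the indices.\<close>

lemma continuous_set_function_sum:
  fixes \<Phi> :: "'a::topological_space \<Rightarrow> nat \<Rightarrow> real"
  assumes cont: "\<And>k. k < D \<Longrightarrow> continuous_on UNIV (\<lambda>x. \<Phi> x k)"
    and zero: "\<And>x k. k \<ge> D \<Longrightarrow> \<Phi> x k = 0"
  shows "continuous_set_function M (Euclidean_space D) (sum_set_function \<Phi>)"
  unfolding continuous_set_function_def
proof (intro allI impI)
  fix m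
  let ?T = "subtopology (product_topology (\<lambda>_. euclidean) {..<m}) {x::nat \<Rightarrow> 'a. inj_on x {..<m}}"
  have "continuous_map ?T euclideanreal (\<lambda>x. \<Sum>j<m. \<Phi> (x j) k)" if "k < D" for k
  proof (rule continuous_map_sum)
    fix j assume "j \<in> {..<m}"
    then have "continuous_map ?T euclidean (\<lambda>x. x j)"
      by (intro continuous_map_from_subtopology continuous_map_product_projection)
    moreover have "continuous_map euclidean euclideanreal (\<lambda>x. \<Phi> x k)"
      using cont [OF that] by simp
    ultimately show "continuous_map ?T euclideanreal (\<lambda>x. \<Phi> (x j) k)"
      by (rule continuous_map_compose [unfolded o_def])
  qed simp
  then have "continuous_map ?T (Euclidean_space D) (\<lambda>x k. if k < D then \<Sum>j<m. \<Phi> (x j) k else 0)"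
    by (simp add: continuous_map_componentwise_Euclidean_space)
  then show "continuous_map ?T (Euclidean_space D) (\<lambda>x. sum_set_function \<Phi> (x ` {..<m}))"
    by (rule continuous_map_eq)
      (auto simp: sum_set_function_def sum.reindex zero fun_eq_iff)
qed

theorem theorem2:
  fixes M :: nat
  shows "\<exists>D::nat. D > 0 \<and>
    infinite {\<Phi> :: real ^ 'd \<Rightarrow> nat \<Rightarrow> real.
      continuous_map euclidean (Euclidean_space D) \<Phi> \<and>
      continuous_set_function M (Euclidean_space D) (sum_set_function \<Phi>) \<and>
      inj_on (sum_set_function \<Phi>) (sets_upto M)}"
proof -
  \<comment> \<open>Two sets of at most \<open>M\<close> points give at most \<open>2 * M\<close>
    linear factors.\<close>
  define L :: "'d list set" where "L = {l. length l \<le> 2 * M}"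
  define D where "D = card L"
  have "finite L"
    using finite_lists_length_le [of "UNIV :: 'd set" "2 * M"] by (simp add: L_def)
  then obtain h where "bij_betw h {0..<D} L"
    unfolding D_def using ex_bij_betw_nat_finite by blast
  then have onto: "\<exists>k<D. h k = l" if "l \<in> L" for l
    using that by (auto simp: bij_betw_def)
  define \<Phi> :: "real \<Rightarrow> real ^ 'd \<Rightarrow> nat \<Rightarrow> real"
    where "\<Phi> c x k = (if k < D then c * list_monomial (h k) x else 0)" for c x k
  \<comment> \<open>The empty monomial is constantly 1, so coordinate \<open>k0\<close> of
    \<open>\<Phi> c\<close> is \<open>c\<close> at every point. This makes the scaled maps distinct,
    and the existence of \<open>k0\<close> gives \<open>D > 0\<close>.\<close>
  obtain k0 where k0: "k0 < D" "h k0 = []"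
    using onto [of "[]"] by (auto simp: L_def)
  have cont: "continuous_on UNIV (\<lambda>x. c * list_monomial l x)" for c and l :: "'d list"
    by (intro continuous_on_mult_left continuous_on_list_monomial)
  have "continuous_map euclidean (Euclidean_space D) (\<Phi> c)" for c
    using continuous_map_componentwise_Euclidean_space
      [of euclidean D "\<lambda>x k. c * list_monomial (h k) x"]
    by (simp add: \<Phi>_def [abs_def] cont)
  moreover have "continuous_set_function M (Euclidean_space D) (sum_set_function (\<Phi> c))" for c
    by (rule continuous_set_function_sum) (simp_all add: cont \<Phi>_def)
  moreover have "inj_on (sum_set_function (\<Phi> c)) (sets_upto M)" if "c > 0" for c
  proof (rule inj_onI)
    fix X Y :: "(real ^ 'd) set"
    assume XY: "X \<in> sets_upto M" "Y \<in> sets_upto M"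
      and eq: "sum_set_function (\<Phi> c) X = sum_set_function (\<Phi> c) Y"
    have "(\<Sum>x\<in>X. list_monomial l x) = (\<Sum>x\<in>Y. list_monomial l x)"
      if "length l \<le> 2 * M" for l :: "'d list"
    proof -
      obtain k where "k < D" "h k = l"
        using onto \<open>length l \<le> 2 * M\<close> by (auto simp: L_def)
      \<comment> \<open>Coordinate \<open>k\<close> of the sums is \<open>c\<close> times the sum of
        the monomial \<open>l\<close>, and \<open>c\<close> cancels.\<close>
      then show ?thesis
        using fun_cong [OF eq, of k] \<open>c > 0\<close>
        by (simp add: sum_set_function_def \<Phi>_def flip: sum_distrib_left)
    qed
    then show "X = Y"
      using XY subset_if_list_monomial_sums_eq [of "2 * M" X Y]
        subset_if_list_monomial_sums_eq [of "2 * M" Y X]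
      by (simp add: sets_upto_def subset_antisym)
  qed
  moreover have "inj_on \<Phi> {0<..}"
  proof (rule inj_onI)
    fix b c assume "\<Phi> b = \<Phi> c"
    then have "\<Phi> b 0 k0 = \<Phi> c 0 k0"
      by simp
    then show "b = c"
      by (simp add: \<Phi>_def k0)
  qed
  then have "infinite (\<Phi> ` {0<..})"
    by (simp add: finite_image_iff infinite_Ioi)
  ultimately have "infinite {\<Phi> :: real ^ 'd \<Rightarrow> nat \<Rightarrow> real.
      continuous_map euclidean (Euclidean_space D) \<Phi> \<and>
      continuous_set_function M (Euclidean_space D) (sum_set_function \<Phi>) \<and>
      inj_on (sum_set_function \<Phi>) (sets_upto M)}"
    by (elim infinite_super [rotated]) blast
  moreover have "D > 0"
    using k0(1) by simp
  ultimately show ?thesis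
    by (intro exI conjI)
qed

end
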